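(* Let $n$ be an odd positive integer and let $D\subset\mathbb R^n$ be a bounded polynomially integrable domain with $C^\infty$ boundary. Then for almost all $\omega\in S^{n-1}$ (with respect to the surface measure) the degree of the polynomial in $t$ with which $V_D(\omega,\cdot)$ coincides is at least $n-1$. In particular, there are no bounded polynomially integrable domains in $\mathbb R^n$ with $C^\infty$ boundary of degree less than $n-1$.
   Context: A domain is a nonempty connected open set. For a bounded domain $D\subset\mathbb R^n$, $\omega\in S^{n-1}$ and $t\in\mathbb R$, the section-volume function $V_D(\omega,t)$ is the $(n-1)$-dimensional volume of $D\cap\{x\in\mathbb R^n:\langle\omega,x\rangle=t\}$, i.e. the Radon transform of the characteristic function $\chi_D$. The domain $D$ is called polynomially integrable if there are an integer $N\ge 0$ and real-valued functions $a_0,\dots,a_N$ on $S^{n-1}$, with $a_N$ not identically zero, such that $V_D(\omega,t)=\sum_{j=0}^N a_j(\omega)t^j$ for all $(\omega,t)\in S^{n-1}\times\mathbb R$ such that the hyperplane $\{\langle\omega,x\rangle=t\}$ intersects $D$. The number $N$ is called the degree of the polynomially integrable domain $D$. *)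

theory Defs
  imports "HOL-Analysis.Analysis"
begin

definition orthonormal_basis_of :: "'a::euclidean_space set \<Rightarrow> 'a set \<Rightarrow> bool" where
  "orthonormal_basis_of B S \<longleftrightarrow>
     pairwise orthogonal B \<and> (\<forall>b\<in>B. norm b = 1) \<and> span B = S"

lemma orthonormal_basis_of_exists:
  fixes S :: "'a::euclidean_space set"
  assumes "subspace S"
  shows "\<exists>B. orthonormal_basis_of B S"
  using orthonormal_basis_subspace[OF assms] unfolding orthonormal_basis_of_def by metis

definition direction_basis :: "'a::euclidean_space \<Rightarrow> 'a set" where
  "direction_basis \<omega> = (SOME B. orthonormal_basis_of B {x. \<omega> \<bullet> x = 0})"

lemma orthonormal_direction_basis:
  "orthonormal_basis_of (direction_basis \<omega>) {x. \<omega> \<bullet> x = 0}"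
  unfolding direction_basis_def
  by (rule someI_ex) (rule orthonormal_basis_of_exists[OF subspace_hyperplane])

lemma finite_direction_basis: "finite (direction_basis \<omega>)"
proof -
  have B: "pairwise orthogonal (direction_basis \<omega>)" "\<forall>b\<in>direction_basis \<omega>. norm b = 1"
    using orthonormal_direction_basis[of \<omega>] by (auto simp: orthonormal_basis_of_def)
  show ?thesis by (rule pairwise_orthogonal_imp_finite[OF B(1)])
qed

text \<open>
  For a unit vector \<open>\<omega>\<close>, the Lebesgue measure of dimension \<open>DIM('a) - 1\<close> carried by the hyperplane
  \<open>\<omega> \<bullet> x = t\<close>. It is the image of product Lebesgue measure under orthonormal coordinates
  (the construction of \<^const>\<open>lborel\<close>). The choice of the orthonormal basis is immaterial,
  since Lebesgue measure is invariant under orthogonal maps. In dimension one the basis is empty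
  and this is the unit point mass at \<open>t *\<^sub>R \<omega>\<close>.
\<close>

definition hyperplane_measure :: "'a::euclidean_space \<Rightarrow> real \<Rightarrow> 'a measure" where
  "hyperplane_measure \<omega> t =
     distr (\<Pi>\<^sub>M b\<in>direction_basis \<omega>. (lborel :: real measure)) borel
       (\<lambda>f. t *\<^sub>R \<omega> + (\<Sum>b\<in>direction_basis \<omega>. f b *\<^sub>R b))"

definition section_volume :: "'a::euclidean_space set \<Rightarrow> 'a \<Rightarrow> real \<Rightarrow> real" where
  "section_volume D \<omega> t = measure (hyperplane_measure \<omega> t) (D \<inter> {x. \<omega> \<bullet> x = t})"

definition polynomially_integrable_of_degree :: "nat \<Rightarrow> 'a::euclidean_space set \<Rightarrow> bool" where
  "polynomially_integrable_of_degree N D \<longleftrightarrow>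
     (\<exists>a :: nat \<Rightarrow> 'a \<Rightarrow> real.
        (\<exists>\<omega>\<in>sphere 0 1. a N \<omega> \<noteq> 0) \<and>
        (\<forall>\<omega>\<in>sphere 0 1. \<forall>t. D \<inter> {x. \<omega> \<bullet> x = t} \<noteq> {} \<longrightarrow>
           section_volume D \<omega> t = (\<Sum>j\<le>N. a j \<omega> * t ^ j)))"

definition polynomially_integrable :: "'a::euclidean_space set \<Rightarrow> bool" where
  "polynomially_integrable D \<longleftrightarrow> (\<exists>N. polynomially_integrable_of_degree N D)"

definition section_polynomial :: "'a::euclidean_space set \<Rightarrow> 'a \<Rightarrow> real poly" where
  "section_polynomial D \<omega> =
     (THE p. \<forall>t. D \<inter> {x. \<omega> \<bullet> x = t} \<noteq> {} \<longrightarrow> section_volume D \<omega> t = poly p t)"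

text \<open>
  For a nonempty open set the hyperplanes orthogonal to \<open>\<omega>\<close> that meet it form an infinite family,
  so the polynomial in the above definite description is unique.
\<close>

lemma infinite_hyperplanes_meeting_open:
  fixes D :: "'a::euclidean_space set"
  assumes "open D" "D \<noteq> {}" "\<omega> \<noteq> 0"
  shows "infinite {t. D \<inter> {x. \<omega> \<bullet> x = t} \<noteq> {}}"
proof -
  obtain x e where x: "x \<in> D" and e: "e > 0" "ball x e \<subseteq> D"
    using assms(1,2) by (meson openE ex_in_conv)
  let ?d = "e / norm \<omega>"
  have d: "?d > 0" using e assms(3) by simp
  have "(\<lambda>s. \<omega> \<bullet> (x + s *\<^sub>R \<omega>)) ` {0<..<?d} \<subseteq> {t. D \<inter> {x. \<omega> \<bullet> x = t} \<noteq> {}}"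
  proof clarsimp
    fix s assume s: "0 < s" "s < ?d"
    then have "s * norm \<omega> < e" using assms(3) by (simp add: field_simps)
    then have "x + s *\<^sub>R \<omega> \<in> D" using e s by (auto simp: dist_norm intro!: subsetD[OF e(2)])
    moreover assume "D \<inter> {y. \<omega> \<bullet> y = \<omega> \<bullet> (x + s *\<^sub>R \<omega>)} = {}"
    ultimately show False by blast
  qed
  moreover have "inj_on (\<lambda>s. \<omega> \<bullet> (x + s *\<^sub>R \<omega>)) {0<..<?d}"
    using assms(3) by (auto simp: inj_on_def inner_add_right)
  moreover have "infinite {0<..<?d}" using d infinite_Ioo by blast
  ultimately show ?thesis by (meson finite_imageD finite_subset)
qed

lemma section_polynomial_eqI:
  fixes D :: "'a::euclidean_space set"
  assumes "open D" "D \<noteq> {}" "\<omega> \<noteq> 0"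
    and p: "\<And>t. D \<inter> {x. \<omega> \<bullet> x = t} \<noteq> {} \<Longrightarrow> section_volume D \<omega> t = poly p t"
  shows "section_polynomial D \<omega> = p"
  unfolding section_polynomial_def
proof (rule the_equality)
  show "\<forall>t. D \<inter> {x. \<omega> \<bullet> x = t} \<noteq> {} \<longrightarrow> section_volume D \<omega> t = poly p t"
    using p by blast
next
  fix q assume q: "\<forall>t. D \<inter> {x. \<omega> \<bullet> x = t} \<noteq> {} \<longrightarrow> section_volume D \<omega> t = poly q t"
  have "{t. D \<inter> {x. \<omega> \<bullet> x = t} \<noteq> {}} \<subseteq> {t. poly (q - p) t = 0}"
    using p q by auto
  then have "infinite {t. poly (q - p) t = 0}"
    using infinite_hyperplanes_meeting_open[OF assms(1-3)] finite_subset by blast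
  then show "q = p" using poly_roots_finite[of "q - p"] by force
qed

text \<open>
  \<open>Ck_on k f S\<close>: all iterated directional derivatives of \<open>f\<close> up to order \<open>k\<close> exist and are
  continuous, for an open set \<open>S\<close>.
\<close>

primrec Ck_on :: "nat \<Rightarrow> ('a::real_normed_vector \<Rightarrow> 'b::real_normed_vector) \<Rightarrow> 'a set \<Rightarrow> bool" where
  "Ck_on 0 f S \<longleftrightarrow> continuous_on S f"
| "Ck_on (Suc k) f S \<longleftrightarrow>
     (\<forall>x\<in>S. f differentiable (at x)) \<and>
     (\<forall>v. Ck_on k (\<lambda>x. frechet_derivative f (at x) v) S)"

definition smooth_on :: "'a::real_normed_vector set \<Rightarrow> ('a \<Rightarrow> 'b::real_normed_vector) \<Rightarrow> bool" where
  "smooth_on S f \<longleftrightarrow> (\<forall>k. Ck_on k f S)"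

text \<open>
  Near each boundary point, \<open>D\<close> is the negativity set of a smooth local defining function
  with nowhere vanishing differential; in particular \<open>D\<close> lies on one side of its boundary.
\<close>

definition smooth_boundary :: "'a::euclidean_space set \<Rightarrow> bool" where
  "smooth_boundary D \<longleftrightarrow>
     (\<forall>p\<in>frontier D. \<exists>U (\<rho> :: 'a \<Rightarrow> real).
        open U \<and> p \<in> U \<and> smooth_on U \<rho> \<and>
        (\<forall>x\<in>U. frechet_derivative \<rho> (at x) \<noteq> (\<lambda>v. 0)) \<and>
        D \<inter> U = {x \<in> U. \<rho> x < 0})"

text \<open>
  The surface measure given by polar coordinates: the area of \<open>A\<close> is \<open>DIM('a)\<close> times the volume
  of the cone \<open>{r *\<^sub>R \<omega> | 0 < r < 1, \<omega> \<in> A}\<close>. In dimension one it counts points.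
\<close>

definition surface_measure :: "'a::euclidean_space measure" where
  "surface_measure =
     scale_measure (ennreal (real DIM('a)))
       (distr (restrict_space lborel (ball 0 1 - {0})) (restrict_space borel (sphere 0 1)) sgn)"

lemma space_surface_measure: "space surface_measure = sphere 0 1"
  by (simp add: surface_measure_def space_scale_measure space_restrict_space)

lemma measurable_sgn_sphere:
  "(sgn :: 'a::euclidean_space \<Rightarrow> 'a) \<in>
     restrict_space lborel (ball 0 1 - {0}) \<rightarrow>\<^sub>M restrict_space borel (sphere 0 1)"
  by (rule measurable_restrict_space2)
     (auto simp: space_restrict_space norm_sgn intro!: measurable_restrict_space1)

lemma emeasure_surface_measure:
  fixes A :: "'a::euclidean_space set"
  assumes "A \<in> sets borel" "A \<subseteq> sphere 0 1"
  shows "emeasure surface_measure A =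
    ennreal (real DIM('a)) * emeasure lborel {x \<in> ball 0 1 - {0}. sgn x \<in> A}"
proof -
  have A: "A \<in> sets (restrict_space borel (sphere 0 1))"
    using assms by (auto simp: sets_restrict_space_iff)
  have eq: "sgn -` A \<inter> space (restrict_space lborel (ball 0 1 - {0}))
      = {x \<in> ball 0 1 - {0}. sgn x \<in> A}"
    by (auto simp: space_restrict_space)
  show ?thesis
    unfolding surface_measure_def emeasure_scale_measure
      emeasure_distr[OF measurable_sgn_sphere A] eq
    by (subst emeasure_restrict_space) auto
qed

end

theory Submission
  imports Defs
begin

text \<open>
  Let \<open>h\<close> be the support function of \<open>D\<close>. It is convex and Lipschitz, so its second differences in
  direction \<open>v\<close> are nonnegative and have integral \<open>O(norm v ^ 2)\<close> over the unit ball. By Fatou's lemma,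
  for almost every \<open>\<omega>\<close> there are arbitrarily small \<open>\<epsilon>\<close> for which the second differences of \<open>h\<close> at \<open>\<omega>\<close>
  with step \<open>\<epsilon>\<close> along the coordinate axes are \<open>O(\<epsilon>^2)\<close>. For such \<open>\<epsilon>\<close> the cap of \<open>D\<close> of height \<open>\<epsilon>^2\<close> in
  direction \<open>\<omega>\<close> has diameter \<open>O(\<epsilon>)\<close>, so the section at \<open>t = h \<omega> - \<epsilon>^2\<close> has volume \<open>O(\<epsilon>^(n-1))\<close>. Hence the
  section polynomial, which is positive between the two supporting hyperplanes, vanishes to order at
  least \<open>(n-1)/2\<close> at \<open>h \<omega>\<close>, and likewise at the other end \<open>- h (- \<omega>)\<close>.
\<close>

subsection \<open>Second differences of convex functions\<close>

definition second_difference :: "('a::real_vector \<Rightarrow> real) \<Rightarrow> 'a \<Rightarrow> 'a \<Rightarrow> real" where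
  "second_difference h v x = h (x + v) + h (x - v) - 2 * h x"

lemma integrable_continuous_compact_support:
  fixes f :: "'a::euclidean_space \<Rightarrow> real"
  assumes "continuous_on UNIV f" "compact S" "\<And>x. x \<notin> S \<Longrightarrow> f x = 0"
  shows "integrable lborel f"
proof -
  have "integrable lborel (\<lambda>x. indicator S x *\<^sub>R f x)"
    using assms continuous_on_subset by (intro borel_integrable_compact) blast+
  moreover have "(\<lambda>x. indicator S x *\<^sub>R f x) = f"
    using assms(3) by (auto simp: indicator_def fun_eq_iff)
  ultimately show ?thesis by simp
qed

lemma lborel_integral_translate:
  fixes f :: "'a::euclidean_space \<Rightarrow> real"
  assumes "f \<in> borel_measurable borel"
  shows "(\<integral>x. f (c + x) \<partial>lborel) = (\<integral>x. f x \<partial>lborel)"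
proof -
  have "(\<integral>x. f x \<partial>lborel) = (\<integral>x. f x \<partial>distr lborel borel ((+) c))"
    by (simp add: lborel_distr_plus)
  also have "\<dots> = (\<integral>x. f (c + x) \<partial>lborel)"
    by (rule integral_distr) (use assms in auto)
  finally show ?thesis by simp
qed

lemma lipschitz_imp_continuous_on:
  fixes h :: "'a::real_normed_vector \<Rightarrow> real"
  assumes lip: "\<And>x y. \<bar>h x - h y\<bar> \<le> L * norm (x - y)"
  shows "continuous_on UNIV h"
proof (rule lipschitz_on_continuous_on)
  have "\<bar>h x - h y\<bar> \<le> \<bar>L\<bar> * norm (x - y)" for x y
    using lip[of x y] by (smt (verit) mult_right_mono norm_ge_zero)
  then show "\<bar>L\<bar>-lipschitz_on UNIV h"
    by (intro lipschitz_onI) (auto simp: dist_norm)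
qed

text \<open>
  Moving the second difference onto the Lipschitz cut-off \<open>max 0 (2 - norm x)\<close> by translation invariance
  leaves a product of two first differences, each of size \<open>O(norm v)\<close>.
\<close>

lemma nn_integral_second_difference_le:
  fixes h :: "'a::euclidean_space \<Rightarrow> real"
  assumes lip: "\<And>x y. \<bar>h x - h y\<bar> \<le> L * norm (x - y)"
    and convex: "\<And>v x. 0 \<le> second_difference h v x"
    and v: "norm v \<le> 1"
  shows "(\<integral>\<^sup>+x\<in>ball 0 1. ennreal (second_difference h v x) \<partial>lborel)
           \<le> ennreal (L * measure lborel (cball 0 3 :: 'a set) * (norm v)\<^sup>2)"
proof -
  have cont: "continuous_on UNIV h"
    by (rule lipschitz_imp_continuous_on[OF lip])
  define \<phi> :: "'a \<Rightarrow> real" where "\<phi> = (\<lambda>x. max 0 (2 - norm x))"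
  define g where "g = (\<lambda>x. h (x + v) - h x)"
  have c\<phi>: "continuous_on UNIV (\<lambda>x. \<phi> (x + w))" for w
    unfolding \<phi>_def by (intro continuous_intros)
  have cg: "continuous_on UNIV (\<lambda>x. g (x + w))" for w
    unfolding g_def by (intro continuous_intros continuous_on_compose2[OF cont]) auto
  have \<phi>0: "\<phi> (x + w) = 0" if "norm w \<le> 1" "x \<notin> cball 0 3" for x w
  proof -
    have "norm x \<le> norm (x + w) + norm w" by (metis add_diff_cancel_right' norm_triangle_ineq4)
    then show ?thesis using that by (simp add: \<phi>_def)
  qed
  have int: "integrable lborel (\<lambda>x. g (x + w) * \<phi> (x + u))" if "norm u \<le> 1" for w u
    by (rule integrable_continuous_compact_support[where S = "cball 0 3"])
       (use \<phi>0 that in \<open>auto intro!: continuous_intros cg c\<phi>\<close>)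
  have int1: "integrable lborel (\<lambda>x. g x * \<phi> x)" and int2: "integrable lborel (\<lambda>x. g (x - v) * \<phi> x)"
    and int3: "integrable lborel (\<lambda>x. g x * \<phi> (x + v))"
    using int[of 0 0] int[of 0 "-v"] int[of v 0] v by auto
  have sd: "second_difference h v x = g x - g (x - v)" for x
    by (simp add: second_difference_def g_def)
  have "(\<integral>x. g (x - v) * \<phi> x \<partial>lborel) = (\<integral>x. g x * \<phi> (x + v) \<partial>lborel)"
    using lborel_integral_translate[of "\<lambda>x. g (x - v) * \<phi> x" v] int2
    by (simp add: add.commute)
  then have "(\<integral>x. second_difference h v x * \<phi> x \<partial>lborel)
      = (\<integral>x. g x * \<phi> x \<partial>lborel) - (\<integral>x. g x * \<phi> (x + v) \<partial>lborel)"
    using int1 int2 by (simp add: sd left_diff_distrib)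
  also have "\<dots> = (\<integral>x. g x * (\<phi> x - \<phi> (x + v)) \<partial>lborel)"
    using int1 int3 by (simp add: right_diff_distrib)
  also have "\<dots> \<le> (\<integral>x. (L * (norm v)\<^sup>2) * indicator (cball 0 3 :: 'a set) x \<partial>lborel)"
  proof (rule Bochner_Integration.integral_mono)
    show "integrable lborel (\<lambda>x. g x * (\<phi> x - \<phi> (x + v)))"
      using int1 int3 by (simp add: right_diff_distrib)
    show "integrable lborel (\<lambda>x::'a. (L * (norm v)\<^sup>2) * indicator (cball 0 3) x)"
      by (intro integrable_mult_right integrable_real_indicator)
         (use emeasure_lborel_cball_finite[of "0::'a" 3] in auto)
    fix x :: 'a
    have "\<bar>g x\<bar> \<le> L * norm v" using lip[of "x + v" x] by (simp add: g_def)
    moreover have "\<bar>\<phi> x - \<phi> (x + v)\<bar> \<le> norm v"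
      using norm_triangle_ineq3[of "x + v" x] by (simp add: \<phi>_def)
    ultimately have "\<bar>g x\<bar> * \<bar>\<phi> x - \<phi> (x + v)\<bar> \<le> (L * norm v) * norm v"
      by (intro mult_mono) auto
    then have "g x * (\<phi> x - \<phi> (x + v)) \<le> L * (norm v)\<^sup>2"
      by (simp add: abs_mult[symmetric] power2_eq_square mult.assoc)
    then show "g x * (\<phi> x - \<phi> (x + v)) \<le> (L * (norm v)\<^sup>2) * indicator (cball 0 3) x"
      using \<phi>0[of 0 x] \<phi>0[of v x] v by (auto simp: indicator_def)
  qed
  also have "\<dots> = L * measure lborel (cball 0 3 :: 'a set) * (norm v)\<^sup>2" by simp
  finally have le: "(\<integral>x. second_difference h v x * \<phi> x \<partial>lborel) \<le> L * measure lborel (cball 0 3 :: 'a set) * (norm v)\<^sup>2" .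
  have "(\<integral>\<^sup>+x\<in>ball 0 1. ennreal (second_difference h v x) \<partial>lborel)
      \<le> (\<integral>\<^sup>+x. ennreal (second_difference h v x * \<phi> x) \<partial>lborel)"
  proof (rule nn_integral_mono)
    fix x :: 'a
    \<comment> \<open>The cut-off is at least 1 on the unit ball. Nonnegativity of the second
      difference allows inserting it here and extending the integral to the whole space.\<close>
    have "second_difference h v x * 1 \<le> second_difference h v x * \<phi> x" if "norm x < 1"
      using that convex by (intro mult_left_mono) (auto simp: \<phi>_def)
    then show "ennreal (second_difference h v x) * indicator (ball 0 1) x
        \<le> ennreal (second_difference h v x * \<phi> x)"
      by (auto simp: indicator_def intro!: ennreal_leI)
  qed
  also have "\<dots> = ennreal (\<integral>x. second_difference h v x * \<phi> x \<partial>lborel)"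
  proof (rule nn_integral_eq_integral)
    show "integrable lborel (\<lambda>x. second_difference h v x * \<phi> x)"
      using int1 int2 by (simp add: sd left_diff_distrib)
    show "AE x in lborel. 0 \<le> second_difference h v x * \<phi> x"
      using convex by (intro AE_I2 mult_nonneg_nonneg) (auto simp: \<phi>_def)
  qed
  also have "\<dots> \<le> ennreal (L * measure lborel (cball 0 3 :: 'a set) * (norm v)\<^sup>2)"
    by (rule ennreal_leI[OF le])
  finally show ?thesis .
qed

text \<open>Asking for arbitrarily small \<epsilon>, with C depending on x, is what a finite liminf
  delivers, and it is enough to bound the order of a polynomial root from below.\<close>

definition frequently_quadratic_at :: "('a::euclidean_space \<Rightarrow> real) \<Rightarrow> 'a \<Rightarrow> bool" where
  "frequently_quadratic_at h x \<longleftrightarrow>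
     (\<exists>C. \<forall>\<delta>>0. \<exists>\<epsilon>. 0 < \<epsilon> \<and> \<epsilon> < \<delta> \<and>
        (\<Sum>b\<in>Basis. second_difference h (\<epsilon> *\<^sub>R b) x) < C * \<epsilon>\<^sup>2)"

lemma continuous_on_second_difference:
  fixes h :: "'a::real_normed_vector \<Rightarrow> real"
  assumes cont: "continuous_on UNIV h"
  shows "continuous_on UNIV (second_difference h v)"
proof -
  have "continuous_on UNIV (\<lambda>x. h (x + v) + h (x - v) - 2 * h x)"
    by (intro continuous_intros continuous_on_compose2[OF cont]) auto
  then show ?thesis by (simp add: second_difference_def[abs_def])
qed

text \<open>Along the steps \<open>e k\<close>, the sums of second differences divided by
  \<open>(e k)^2\<close> have integrals over the unit ball bounded uniformly in k. By Fatou's lemma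
  their liminf is integrable, hence finite almost everywhere, and any m above it bounds
  \<open>F k x\<close> for infinitely many k.\<close>

lemma AE_frequently_quadratic:
  fixes h :: "'a::euclidean_space \<Rightarrow> real"
  assumes lip: "\<And>x y. \<bar>h x - h y\<bar> \<le> L * norm (x - y)"
    and convex: "\<And>v x. 0 \<le> second_difference h v x"
  shows "AE x in lborel. x \<in> ball 0 1 \<longrightarrow> frequently_quadratic_at h x"
proof -
  define e where "e k = 1 / real (Suc k)" for k
  have e: "0 < e k" "e k \<le> 1" for k by (auto simp: e_def)
  define K where "K = ennreal (L * measure lborel (cball 0 3 :: 'a set))"
  define F where "F k x = (\<Sum>b\<in>Basis. ennreal (second_difference h (e k *\<^sub>R b) x)) 
      * indicator (ball 0 1) x / ennreal ((e k)\<^sup>2)" for k x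
  have [measurable]: "(\<lambda>x. second_difference h v x) \<in> borel_measurable borel" for v
    by (rule borel_measurable_continuous_onI)
       (rule continuous_on_second_difference[OF lipschitz_imp_continuous_on[OF lip]])
  have [measurable]: "Measurable.pred borel (\<lambda>x::'a. x \<in> ball 0 1)" by (simp add: pred_def)
  have [measurable]: "F k \<in> borel_measurable lborel" for k
    unfolding F_def by measurable
  have "(\<integral>\<^sup>+x. F k x \<partial>lborel) \<le> of_nat DIM('a) * K" for k
  proof -
    have "(\<integral>\<^sup>+x. F k x \<partial>lborel) = (\<integral>\<^sup>+x. (\<Sum>b\<in>Basis. ennreal (second_difference h (e k *\<^sub>R b) x)
        * indicator (ball 0 1) x) \<partial>lborel) / ennreal ((e k)\<^sup>2)"
      unfolding F_def sum_distrib_right by (rule nn_integral_divide) measurable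
    also have "\<dots> = (\<Sum>b\<in>Basis. \<integral>\<^sup>+x\<in>ball 0 1. ennreal (second_difference h (e k *\<^sub>R b) x) \<partial>lborel) / ennreal ((e k)\<^sup>2)"
      by (intro arg_cong2[where f = "(/)"] nn_integral_sum refl) measurable
    also have "\<dots> \<le> (\<Sum>b\<in>(Basis::'a set). K * ennreal ((e k)\<^sup>2)) / ennreal ((e k)\<^sup>2)"
    proof (intro divide_right_mono_ennreal sum_mono)
      fix b :: 'a assume b: "b \<in> Basis"
      have "(\<integral>\<^sup>+x\<in>ball 0 1. ennreal (second_difference h (e k *\<^sub>R b) x) \<partial>lborel)
          \<le> ennreal (L * measure lborel (cball 0 3 :: 'a set) * (norm (e k *\<^sub>R b))\<^sup>2)"
        by (rule nn_integral_second_difference_le[OF lip convex]) (use b e[of k] in auto)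
      then show "(\<integral>\<^sup>+x\<in>ball 0 1. ennreal (second_difference h (e k *\<^sub>R b) x) \<partial>lborel) \<le> K * ennreal ((e k)\<^sup>2)"
        using b by (simp add: K_def ennreal_mult'')
    qed
    also have "\<dots> = of_nat DIM('a) * K"
      using e[of k] by (simp add: mult.assoc[symmetric] ennreal_mult_divide_eq)
    finally show ?thesis .
  qed
  then have "liminf (\<lambda>k. \<integral>\<^sup>+x. F k x \<partial>lborel) \<le> liminf (\<lambda>k::nat. of_nat DIM('a) * K)"
    by (intro Liminf_mono) auto
  then have "(\<integral>\<^sup>+x. liminf (\<lambda>k. F k x) \<partial>lborel) \<le> of_nat DIM('a) * K"
    using nn_integral_liminf[of F lborel] by (simp add: Liminf_const)
  also have "\<dots> < \<infinity>" by (simp add: K_def ennreal_mult_less_top of_nat_less_top)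
  finally have "AE x in lborel. liminf (\<lambda>k. F k x) \<noteq> \<infinity>"
    by (intro nn_integral_PInf_AE) auto
  then show ?thesis
  proof (rule AE_mp, intro AE_I2 impI)
    fix x :: 'a assume fin: "liminf (\<lambda>k. F k x) \<noteq> \<infinity>" and x: "x \<in> ball 0 1"
    then obtain m :: nat where m: "liminf (\<lambda>k. F k x) < of_nat m"
      using ennreal_Ex_less_of_nat top.not_eq_extremum by (metis infinity_ennreal_def)
    show "frequently_quadratic_at h x"
      unfolding frequently_quadratic_at_def
    proof (rule exI[of _ "real m"], intro allI impI)
      fix \<delta> :: real assume "0 < \<delta>"
      then have "\<forall>\<^sub>F k in sequentially. e k < \<delta>"
        unfolding e_def using LIMSEQ_inverse_real_of_nat[THEN order_tendstoD(2)]
        by (simp add: inverse_eq_divide)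
      moreover have "\<exists>\<^sub>F k in sequentially. F k x < of_nat m"
      proof (rule ccontr)
        assume "\<not> ?thesis"
        then have "\<forall>\<^sub>F k in sequentially. of_nat m \<le> F k x"
          by (simp add: not_frequently not_less)
        then show False using Liminf_bounded m by (metis not_less)
      qed
      ultimately obtain k where k: "e k < \<delta>" "F k x < of_nat m"
        by (metis (mono_tags, lifting) eventually_frequently_simps(1) frequently_ex frequently_eventually_frequently)
      \<comment> \<open>Since \<open>ennreal\<close> truncates negative reals to 0, returning to a
        real inequality uses that the second differences are nonnegative.\<close>
      have "ennreal ((\<Sum>b\<in>Basis. second_difference h (e k *\<^sub>R b) x) / (e k)\<^sup>2) = F k x"
        using x e[of k] convex by (simp add: F_def sum_ennreal sum_nonneg divide_ennreal)
      also have "\<dots> < ennreal (real m)" using k(2) by (simp add: ennreal_of_nat_eq_real_of_nat)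
      finally have "(\<Sum>b\<in>Basis. second_difference h (e k *\<^sub>R b) x) < real m * (e k)\<^sup>2"
        using e[of k] convex by (simp add: ennreal_less_iff sum_nonneg field_simps)
      then show "\<exists>\<epsilon>>0. \<epsilon> < \<delta> \<and> (\<Sum>b\<in>Basis. second_difference h (\<epsilon> *\<^sub>R b) x) < real m * \<epsilon>\<^sup>2"
        using e k by blast
    qed
  qed
qed

text \<open>
  The strict inequality, required for real rather than rational \<open>\<epsilon>\<close>, makes the set a countable
  combination of open sets and at the same time invariant under scaling.
\<close>

lemma frequently_quadratic_at_borel:
  fixes h :: "'a::euclidean_space \<Rightarrow> real"
  assumes cont: "continuous_on UNIV h"
  shows "{x. frequently_quadratic_at h x} \<in> sets borel"
proof -
  \<comment> \<open>Natural numbers exhaust the constants C because the condition weakens as C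
    grows, and the bounds 1/(j+1) exhaust the \<delta>. The union over all real \<epsilon> is
    harmless, its members being open.\<close>
  define U where "U C j = (\<Union>\<epsilon>\<in>{0<..<1 / real (Suc j)}. 
      {x. (\<Sum>b\<in>Basis. second_difference h (\<epsilon> *\<^sub>R b) x) < real C * \<epsilon>\<^sup>2})" for C j :: nat
  have "open (U C j)" for C j
    unfolding U_def
    by (intro open_UN ballI open_Collect_less continuous_intros continuous_on_second_difference cont)
  moreover have "{x. frequently_quadratic_at h x} = (\<Union>C. \<Inter>j. U C j)"
  proof (intro set_eqI iffI)
    fix x assume "x \<in> {x. frequently_quadratic_at h x}"
    then obtain C where C: "\<And>\<delta>. 0 < \<delta> \<Longrightarrow> \<exists>\<epsilon>. 0 < \<epsilon> \<and> \<epsilon> < \<delta> \<and>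
        (\<Sum>b\<in>Basis. second_difference h (\<epsilon> *\<^sub>R b) x) < C * \<epsilon>\<^sup>2"
      by (auto simp: frequently_quadratic_at_def)
    obtain m :: nat where m: "C \<le> real m" using real_arch_simple by blast
    have "x \<in> U m j" for j
    proof -
      obtain \<epsilon> where "0 < \<epsilon>" "\<epsilon> < 1 / real (Suc j)"
        and "(\<Sum>b\<in>Basis. second_difference h (\<epsilon> *\<^sub>R b) x) < C * \<epsilon>\<^sup>2"
        using C[of "1 / real (Suc j)"] by auto
      moreover have "C * \<epsilon>\<^sup>2 \<le> real m * \<epsilon>\<^sup>2" using m by (intro mult_right_mono) auto
      ultimately show ?thesis unfolding U_def
        by (intro UN_I[of \<epsilon>] CollectI greaterThanLessThan_iff[THEN iffD2] conjI) linarith+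
    qed
    then show "x \<in> (\<Union>C. \<Inter>j. U C j)" by blast
  next
    fix x assume "x \<in> (\<Union>C. \<Inter>j. U C j)"
    then obtain C where C: "\<And>j. x \<in> U C j" by blast
    have "\<exists>\<epsilon>. 0 < \<epsilon> \<and> \<epsilon> < \<delta> \<and> (\<Sum>b\<in>Basis. second_difference h (\<epsilon> *\<^sub>R b) x) < real C * \<epsilon>\<^sup>2"
      if \<delta>: "\<delta> > 0" for \<delta>
    proof -
      obtain j where "1 / real (Suc j) < \<delta>" using nat_approx_posE[OF \<delta>] by auto
      then show ?thesis using C[of j] unfolding U_def by force
    qed
    then show "x \<in> {x. frequently_quadratic_at h x}"
      by (auto simp: frequently_quadratic_at_def)
  qed
  ultimately show ?thesis by auto
qed

text \<open>Homogeneity turns the step \<epsilon> at \<open>r *\<^sub>R x\<close> into the step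
  \<epsilon>/r at x, with C replaced by C * r. The property is thus constant along rays.\<close>

lemma frequently_quadratic_at_scale:
  fixes h :: "'a::euclidean_space \<Rightarrow> real"
  assumes hom: "\<And>r x. 0 < r \<Longrightarrow> h (r *\<^sub>R x) = r * h x"
    and r: "0 < r" and x: "frequently_quadratic_at h (r *\<^sub>R x)"
  shows "frequently_quadratic_at h x"
proof -
  obtain C where C: "\<And>\<delta>. 0 < \<delta> \<Longrightarrow> \<exists>\<epsilon>. 0 < \<epsilon> \<and> \<epsilon> < \<delta> \<and>
        (\<Sum>b\<in>Basis. second_difference h (\<epsilon> *\<^sub>R b) (r *\<^sub>R x)) < C * \<epsilon>\<^sup>2"
    using x by (auto simp: frequently_quadratic_at_def)
  have sd: "second_difference h (r *\<^sub>R v) (r *\<^sub>R x) = r * second_difference h v x" for v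
    using hom[OF r, of "x + v"] hom[OF r, of "x - v"] hom[OF r, of x]
    by (simp add: second_difference_def algebra_simps)
  have "\<exists>\<epsilon>. 0 < \<epsilon> \<and> \<epsilon> < \<delta> \<and> (\<Sum>b\<in>Basis. second_difference h (\<epsilon> *\<^sub>R b) x) < (C * r) * \<epsilon>\<^sup>2"
    if \<delta>: "\<delta> > 0" for \<delta>
  proof -
    obtain \<epsilon> where \<epsilon>: "0 < \<epsilon>" "\<epsilon> < r * \<delta>"
      and *: "(\<Sum>b\<in>Basis. second_difference h (\<epsilon> *\<^sub>R b) (r *\<^sub>R x)) < C * \<epsilon>\<^sup>2"
      using C[of "r * \<delta>"] r \<delta> by auto
    define \<eta> where "\<eta> = \<epsilon> / r"
    have \<epsilon>_eq: "\<epsilon> = r * \<eta>" using r by (simp add: \<eta>_def)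
    have "r * (\<Sum>b\<in>Basis. second_difference h (\<eta> *\<^sub>R b) x) < r * (C * r * \<eta>\<^sup>2)"
    proof -
      have "second_difference h (\<epsilon> *\<^sub>R b) (r *\<^sub>R x) = r * second_difference h (\<eta> *\<^sub>R b) x" for b
        using sd[of "\<eta> *\<^sub>R b"] by (simp add: \<epsilon>_eq)
      then show ?thesis using * by (simp add: \<epsilon>_eq sum_distrib_left power2_eq_square mult_ac)
    qed
    then have "(\<Sum>b\<in>Basis. second_difference h (\<eta> *\<^sub>R b) x) < C * r * \<eta>\<^sup>2"
      using r by simp
    then show ?thesis using \<epsilon> r by (intro exI[of _ \<eta>]) (simp add: \<epsilon>_eq zero_less_mult_iff)
  qed
  then show ?thesis by (auto simp: frequently_quadratic_at_def)
qed

text \<open>The surface measure of the exceptional directions is a multiple of the volume of the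
  cone over them. By invariance along rays this cone consists of exceptional points of the ball,
  which form a null set.\<close>

lemma AE_surface_measure_frequently_quadratic:
  fixes h :: "'a::euclidean_space \<Rightarrow> real"
  assumes lip: "\<And>x y. \<bar>h x - h y\<bar> \<le> L * norm (x - y)"
    and convex: "\<And>v x. 0 \<le> second_difference h v x"
    and hom: "\<And>r x. 0 < r \<Longrightarrow> h (r *\<^sub>R x) = r * h x"
  shows "AE \<omega> in surface_measure. frequently_quadratic_at h \<omega>"
proof -
  define A where "A = {\<omega> \<in> sphere 0 1. \<not> frequently_quadratic_at h \<omega>}"
  have A_eq: "A = sphere 0 1 - {x. frequently_quadratic_at h x}" by (auto simp: A_def)
  have A: "A \<in> sets borel" "A \<subseteq> sphere 0 1"
    unfolding A_eq using frequently_quadratic_at_borel[OF lipschitz_imp_continuous_on[OF lip]] by auto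
  have "AE x in lborel. x \<notin> {x \<in> ball 0 1 - {0}. sgn x \<in> A}"
    using AE_frequently_quadratic[OF lip convex]
  proof (rule AE_mp, intro AE_I2 impI)
    fix x :: 'a assume x: "x \<in> ball 0 1 \<longrightarrow> frequently_quadratic_at h x"
    have "frequently_quadratic_at h (sgn x)" if "x \<in> ball 0 1" "x \<noteq> 0"
    proof (rule frequently_quadratic_at_scale[where r = "norm x"])
      show "frequently_quadratic_at h (norm x *\<^sub>R sgn x)"
        using x that by (simp add: sgn_div_norm)
    qed (use hom that in auto)
    then show "x \<notin> {x \<in> ball 0 1 - {0}. sgn x \<in> A}" by (auto simp: A_def)
  qed
  moreover have "{x \<in> ball 0 1 - {0}. sgn x \<in> A} \<in> sets lborel"
  proof -
    have "sgn -` A \<inter> space (restrict_space lborel (ball 0 1 - {0})) \<in> sets (restrict_space lborel (ball 0 1 - {0}))"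
      by (rule measurable_sets[OF measurable_sgn_sphere]) (use A in \<open>auto simp: sets_restrict_space_iff\<close>)
    moreover have "sgn -` A \<inter> space (restrict_space lborel (ball 0 1 - {0})) = {x \<in> ball 0 1 - {0}. sgn x \<in> A}"
      by (auto simp: space_restrict_space)
    ultimately show ?thesis by (simp add: sets_restrict_space_iff)
  qed
  ultimately have "emeasure lborel {x \<in> ball 0 1 - {0}. sgn x \<in> A} = 0"
    by (subst (asm) AE_iff_measurable[OF _ refl]) auto
  then have "emeasure surface_measure A = 0"
    by (simp add: emeasure_surface_measure[OF A])
  moreover have "A \<in> sets surface_measure"
    using A by (auto simp: surface_measure_def sets_restrict_space_iff)
  ultimately show ?thesis
    by (intro AE_I'[of A]) (auto simp: space_surface_measure A_def null_sets_def)
qed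

subsection \<open>Support functions and caps\<close>

definition support_function :: "'a::euclidean_space set \<Rightarrow> 'a \<Rightarrow> real" where
  "support_function D x = (SUP y\<in>D. x \<bullet> y)"

context
  fixes D :: "'a::euclidean_space set"
  assumes bounded: "bounded D" and nonempty: "D \<noteq> {}"
begin

lemma bdd_above_inner: "bdd_above ((\<lambda>y. x \<bullet> y) ` D)"
  by (intro bounded_imp_bdd_above bounded_linear_image[OF bounded bounded_linear_inner_right])

lemma inner_le_support_function: "y \<in> D \<Longrightarrow> x \<bullet> y \<le> support_function D x"
  unfolding support_function_def by (rule cSUP_upper[OF _ bdd_above_inner])

lemma support_function_le: "(\<And>y. y \<in> D \<Longrightarrow> x \<bullet> y \<le> c) \<Longrightarrow> support_function D x \<le> c"
  unfolding support_function_def by (rule cSUP_least[OF nonempty])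

lemma less_support_function_iff: "c < support_function D x \<longleftrightarrow> (\<exists>y\<in>D. c < x \<bullet> y)"
  unfolding support_function_def by (rule less_cSUP_iff[OF nonempty bdd_above_inner])

lemma support_function_lipschitz:
  obtains L where "\<And>x y. \<bar>support_function D x - support_function D y\<bar> \<le> L * norm (x - y)"
proof -
  obtain L where L: "\<And>z. z \<in> D \<Longrightarrow> norm z \<le> L" using bounded by (auto simp: bounded_iff)
  have "support_function D x \<le> support_function D y + L * norm (x - y)" for x y
  proof (rule support_function_le)
    fix z assume z: "z \<in> D"
    have "x \<bullet> z = y \<bullet> z + (x - y) \<bullet> z" by (simp add: inner_diff_left)
    also have "\<dots> \<le> support_function D y + norm (x - y) * norm z"
      using inner_le_support_function[OF z] norm_cauchy_schwarz by (rule add_mono)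
    also have "\<dots> \<le> support_function D y + norm (x - y) * L"
      using L[OF z] by (intro add_left_mono mult_left_mono) auto
    finally show "x \<bullet> z \<le> support_function D y + L * norm (x - y)" by (simp add: mult.commute)
  qed
  then have "\<bar>support_function D x - support_function D y\<bar> \<le> L * norm (x - y)" for x y
    by (smt (verit, best) norm_minus_commute)
  then show ?thesis using that by blast
qed

text \<open>Test the supremum at x + v with y and the one at x - v with z. The subtracted terms are
  the depths of y and z below the supporting hyperplane, so for points of a shallow cap the second
  difference controls their separation along v.\<close>

lemma second_difference_support_function_ge:
  assumes "y \<in> D" "z \<in> D"
  shows "v \<bullet> (y - z) - (support_function D x - x \<bullet> y) - (support_function D x - x \<bullet> z)
     \<le> second_difference (support_function D) v x"
  using inner_le_support_function[OF assms(1), of "x + v"] inner_le_support_function[OF assms(2), of "x - v"]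
  by (simp add: second_difference_def inner_simps)

text \<open>Midpoint convexity: each \<open>x \<bullet> y\<close> is the mean of its values at x + v
  and x - v.\<close>

lemma second_difference_support_function_nonneg:
  "0 \<le> second_difference (support_function D) v x"
proof -
  have "support_function D x \<le> (support_function D (x + v) + support_function D (x - v)) / 2"
  proof (rule support_function_le)
    fix y assume "y \<in> D"
    then show "x \<bullet> y \<le> (support_function D (x + v) + support_function D (x - v)) / 2"
      using inner_le_support_function[of y "x + v"] inner_le_support_function[of y "x - v"]
      by (simp add: inner_simps)
  qed
  then show ?thesis by (simp add: second_difference_def)
qed

lemma support_function_scale:
  assumes "0 < r"
  shows "support_function D (r *\<^sub>R x) = r * support_function D x"
proof (rule antisym)
  show "support_function D (r *\<^sub>R x) \<le> r * support_function D x"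
    using assms by (intro support_function_le) (simp add: inner_le_support_function)
  have "support_function D x \<le> support_function D (r *\<^sub>R x) / r"
    using assms inner_le_support_function[of _ "r *\<^sub>R x"]
    by (intro support_function_le) (auto simp: field_simps)
  then show "r * support_function D x \<le> support_function D (r *\<^sub>R x)"
    using assms by (simp add: field_simps)
qed

text \<open>Take v = \<open>\<epsilon> *\<^sub>R b\<close> in the previous lower bound. Both depths
  are at most \<epsilon>^2, whence the 2 in C + 2, and dividing by \<epsilon> bounds each coordinate
  of y - z. Summing coordinates gives the factor \<open>DIM('a)\<close>.\<close>

lemma cap_diameter_le:
  assumes "0 < \<epsilon>" and y: "y \<in> D" "support_function D x - \<epsilon>\<^sup>2 \<le> x \<bullet> y"
    and z: "z \<in> D" "support_function D x - \<epsilon>\<^sup>2 \<le> x \<bullet> z"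
    and C: "(\<Sum>b\<in>Basis. second_difference (support_function D) (\<epsilon> *\<^sub>R b) x) \<le> C * \<epsilon>\<^sup>2"
  shows "norm (y - z) \<le> real DIM('a) * (C + 2) * \<epsilon>"
proof -
  have le: "(u - w) \<bullet> b \<le> (C + 2) * \<epsilon>"
    if b: "b \<in> Basis" and u: "u \<in> D" "support_function D x - \<epsilon>\<^sup>2 \<le> x \<bullet> u"
      and w: "w \<in> D" "support_function D x - \<epsilon>\<^sup>2 \<le> x \<bullet> w" for u w b
  proof -
    have "second_difference (support_function D) (\<epsilon> *\<^sub>R b) x \<le> C * \<epsilon>\<^sup>2"
      using C member_le_sum[OF b, of "\<lambda>b. second_difference (support_function D) (\<epsilon> *\<^sub>R b) x"]
        second_difference_support_function_nonneg by force
    then have "\<epsilon> * ((u - w) \<bullet> b) \<le> C * \<epsilon>\<^sup>2 + 2 * \<epsilon>\<^sup>2"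
      using second_difference_support_function_ge[OF u(1) w(1), of "\<epsilon> *\<^sub>R b" x] u(2) w(2)
      by (simp add: inner_commute)
    also have "\<dots> = \<epsilon> * ((C + 2) * \<epsilon>)" by (simp add: power2_eq_square algebra_simps)
    finally show ?thesis using \<open>0 < \<epsilon>\<close> by simp
  qed
  have "norm (y - z) \<le> (\<Sum>b\<in>Basis. \<bar>(y - z) \<bullet> b\<bar>)" by (rule norm_le_l1)
  also have "\<dots> \<le> (\<Sum>b\<in>(Basis::'a set). (C + 2) * \<epsilon>)"
  proof (rule sum_mono)
    fix b :: 'a assume b: "b \<in> Basis"
    show "\<bar>(y - z) \<bullet> b\<bar> \<le> (C + 2) * \<epsilon>"
      using le[OF b y z] le[OF b z y] by (simp add: abs_le_iff inner_diff_left)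
  qed
  finally show ?thesis by simp
qed

end

subsection \<open>Volumes of sections\<close>

lemma card_direction_basis:
  fixes \<omega> :: "'a::euclidean_space"
  assumes "\<omega> \<noteq> 0"
  shows "card (direction_basis \<omega>) = DIM('a) - 1"
proof -
  let ?B = "direction_basis \<omega>"
  have B: "pairwise orthogonal ?B" "\<forall>b\<in>?B. norm b = 1" "span ?B = {x. \<omega> \<bullet> x = 0}"
    using orthonormal_direction_basis[of \<omega>] by (auto simp: orthonormal_basis_of_def)
  then have "independent ?B" by (intro pairwise_orthogonal_independent) auto
  then have "card ?B = dim (span ?B)" by (metis dim_span dim_eq_card_independent)
  then show ?thesis using B(3) dim_hyperplane[OF assms] by simp
qed

text \<open>The map along which \<open>hyperplane_measure\<close> pushes product Lebesgue measure
  forward.\<close>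

definition hyperplane_chart :: "'a::euclidean_space \<Rightarrow> real \<Rightarrow> ('a \<Rightarrow> real) \<Rightarrow> 'a" where
  "hyperplane_chart \<omega> t f = t *\<^sub>R \<omega> + (\<Sum>b\<in>direction_basis \<omega>. f b *\<^sub>R b)"

lemma measurable_hyperplane_chart [measurable]:
  "hyperplane_chart \<omega> t \<in> (\<Pi>\<^sub>M b\<in>direction_basis \<omega>. (lborel :: real measure)) \<rightarrow>\<^sub>M borel"
  unfolding hyperplane_chart_def[abs_def] by measurable

lemma hyperplane_measure_eq:
  "hyperplane_measure \<omega> t =
     distr (\<Pi>\<^sub>M b\<in>direction_basis \<omega>. (lborel :: real measure)) borel (hyperplane_chart \<omega> t)"
  by (simp add: hyperplane_measure_def hyperplane_chart_def[abs_def])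

lemma hyperplane_chart_inner:
  assumes "b \<in> direction_basis \<omega>"
  shows "hyperplane_chart \<omega> t f \<bullet> b = f b"
proof -
  have B: "pairwise orthogonal (direction_basis \<omega>)" "\<forall>b\<in>direction_basis \<omega>. norm b = 1"
      "span (direction_basis \<omega>) = {x. \<omega> \<bullet> x = 0}"
    using orthonormal_direction_basis[of \<omega>] by (auto simp: orthonormal_basis_of_def)
  have "\<omega> \<bullet> b = 0" using B(3) span_base[OF assms] by auto
  moreover have "(\<Sum>c\<in>direction_basis \<omega>. f c * (c \<bullet> b)) = (\<Sum>c\<in>direction_basis \<omega>. if c = b then f b else 0)"
    using B(1,2) assms by (intro sum.cong) (auto simp: pairwise_def orthogonal_def norm_eq_1)
  ultimately show ?thesis
    using assms finite_direction_basis[of \<omega>] by (simp add: hyperplane_chart_def inner_simps inner_sum_left)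
qed

lemma inner_hyperplane_chart:
  assumes "norm \<omega> = 1"
  shows "\<omega> \<bullet> hyperplane_chart \<omega> t f = t"
proof -
  have "\<omega> \<bullet> b = 0" if "b \<in> direction_basis \<omega>" for b
    using orthonormal_direction_basis[of \<omega>] span_base[OF that] by (auto simp: orthonormal_basis_of_def)
  then show ?thesis using assms
    by (simp add: hyperplane_chart_def inner_add_right inner_sum_right norm_eq_1)
qed

lemma hyperplane_chart_surj:
  assumes "norm \<omega> = 1"
  obtains f where "x = hyperplane_chart \<omega> (\<omega> \<bullet> x) f"
proof -
  have "\<omega> \<bullet> (x - (\<omega> \<bullet> x) *\<^sub>R \<omega>) = 0" using assms by (simp add: inner_diff_right norm_eq_1)
  then have "x - (\<omega> \<bullet> x) *\<^sub>R \<omega> \<in> span (direction_basis \<omega>)"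
    using orthonormal_direction_basis[of \<omega>] by (auto simp: orthonormal_basis_of_def)
  then obtain f where "x - (\<omega> \<bullet> x) *\<^sub>R \<omega> = (\<Sum>b\<in>direction_basis \<omega>. f b *\<^sub>R b)"
    by (auto simp: span_finite[OF finite_direction_basis])
  then have "x = hyperplane_chart \<omega> (\<omega> \<bullet> x) f" by (simp add: hyperplane_chart_def algebra_simps)
  then show ?thesis using that by blast
qed

lemma emeasure_hyperplane_box:
  assumes "\<And>b. b \<in> direction_basis \<omega> \<Longrightarrow> A b \<in> sets borel"
  shows "emeasure (\<Pi>\<^sub>M b\<in>direction_basis \<omega>. (lborel :: real measure)) (Pi\<^sub>E (direction_basis \<omega>) A)
    = (\<Prod>b\<in>direction_basis \<omega>. emeasure lborel (A b))"
proof -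
  interpret product_sigma_finite "\<lambda>_::'a. lborel :: real measure" ..
  show ?thesis using assms finite_direction_basis by (intro emeasure_PiM) auto
qed

lemma emeasure_hyperplane_measure:
  assumes "A \<in> sets borel"
  shows "emeasure (hyperplane_measure \<omega> t) A =
    emeasure (\<Pi>\<^sub>M b\<in>direction_basis \<omega>. (lborel :: real measure))
      {f \<in> direction_basis \<omega> \<rightarrow>\<^sub>E UNIV. hyperplane_chart \<omega> t f \<in> A}"
  unfolding hyperplane_measure_eq
  by (subst emeasure_distr) (use assms in \<open>auto simp: space_PiM intro!: arg_cong2[where f = emeasure]\<close>)

section \<open>Upper and lower bounds for section volumes\<close>

lemma section_in_borel:
  fixes D :: "'a::euclidean_space set"
  shows "open D \<Longrightarrow> D \<inter> {x. \<omega> \<bullet> x = t} \<in> sets borel"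
  by (intro sets.Int borel_open borel_closed closed_hyperplane)

text \<open>In orthonormal coordinates the section lies in a cube of side 2 * d centred at any one
  of its points. In dimension one the bound is 1, the mass of a point.\<close>

lemma emeasure_section_le:
  fixes D :: "'a::euclidean_space set"
  assumes \<omega>: "norm \<omega> = 1" and D: "open D" and d: "0 \<le> d"
    and diam: "\<And>y z. y \<in> D \<Longrightarrow> z \<in> D \<Longrightarrow> \<omega> \<bullet> y = t \<Longrightarrow> \<omega> \<bullet> z = t \<Longrightarrow> norm (y - z) \<le> d"
  shows "emeasure (hyperplane_measure \<omega> t) (D \<inter> {x. \<omega> \<bullet> x = t}) \<le> ennreal ((2 * d) ^ (DIM('a) - 1))"
proof (cases "D \<inter> {x. \<omega> \<bullet> x = t} = {}")
  case False
  then obtain z where z: "z \<in> D" "\<omega> \<bullet> z = t" by auto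
  let ?B = "direction_basis \<omega>"
  let ?A = "\<lambda>b. {z \<bullet> b - d..z \<bullet> b + d}"
  have "{f \<in> ?B \<rightarrow>\<^sub>E UNIV. hyperplane_chart \<omega> t f \<in> D \<inter> {x. \<omega> \<bullet> x = t}} \<subseteq> Pi\<^sub>E ?B ?A"
  proof (safe intro!: PiE_I)
    fix f b assume f: "hyperplane_chart \<omega> t f \<in> D" "\<omega> \<bullet> hyperplane_chart \<omega> t f = t" and b: "b \<in> ?B"
    have "norm b = 1" using orthonormal_direction_basis[of \<omega>] b by (auto simp: orthonormal_basis_of_def)
    then have "\<bar>(hyperplane_chart \<omega> t f - z) \<bullet> b\<bar> \<le> d"
      using diam[OF f(1) z(1) f(2) z(2)] Cauchy_Schwarz_ineq2[of "hyperplane_chart \<omega> t f - z" b] by simp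
    then show "f b \<in> ?A b"
      using hyperplane_chart_inner[OF b, of t f] by (auto simp: inner_diff_left abs_le_iff)
  qed (auto simp: PiE_def extensional_def)
  then have "emeasure (hyperplane_measure \<omega> t) (D \<inter> {x. \<omega> \<bullet> x = t})
      \<le> emeasure (\<Pi>\<^sub>M b\<in>?B. (lborel :: real measure)) (Pi\<^sub>E ?B ?A)"
    unfolding emeasure_hyperplane_measure[OF section_in_borel[OF D]]
    by (intro emeasure_mono) (auto intro!: sets_PiM_I_finite finite_direction_basis)
  also have "\<dots> = ennreal ((2 * d) ^ (DIM('a) - 1))"
  proof -
    have "\<omega> \<noteq> 0" using \<omega> by auto
    then show ?thesis using d
      by (subst emeasure_hyperplane_box) (auto simp: card_direction_basis ennreal_power)
  qed
  finally show ?thesis .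
qed simp

lemma section_volume_le:
  fixes D :: "'a::euclidean_space set"
  assumes "norm \<omega> = 1" "open D" "0 \<le> d"
    and "\<And>y z. y \<in> D \<Longrightarrow> z \<in> D \<Longrightarrow> \<omega> \<bullet> y = t \<Longrightarrow> \<omega> \<bullet> z = t \<Longrightarrow> norm (y - z) \<le> d"
  shows "section_volume D \<omega> t \<le> (2 * d) ^ (DIM('a) - 1)"
  unfolding section_volume_def measure_def
  using emeasure_section_le[OF assms] assms(3) by (intro enn2real_leI) auto

text \<open>As D is open, the section contains a small coordinate cube around x.\<close>

lemma section_volume_pos:
  fixes D :: "'a::euclidean_space set"
  assumes \<omega>: "norm \<omega> = 1" and D: "open D" "bounded D" and x: "x \<in> D"
  shows "0 < section_volume D \<omega> (\<omega> \<bullet> x)"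
proof -
  let ?B = "direction_basis \<omega>" and ?t = "\<omega> \<bullet> x"
  obtain e where e: "e > 0" "ball x e \<subseteq> D" using D(1) x by (meson openE)
  obtain f where f: "x = hyperplane_chart \<omega> ?t f" using hyperplane_chart_surj[OF \<omega>] .
  \<comment> \<open>With the successor in the denominator, \<open>card ?B * r\<close> stays strictly
    below e and r is meaningful even for an empty basis.\<close>
  define r where "r = e / real (Suc (card ?B))"
  have r: "r > 0" using e by (simp add: r_def)
  let ?A = "\<lambda>b. {f b - r..f b + r}"
  have sub: "Pi\<^sub>E ?B ?A \<subseteq> {g \<in> ?B \<rightarrow>\<^sub>E UNIV. hyperplane_chart \<omega> ?t g \<in> D \<inter> {x. \<omega> \<bullet> x = ?t}}"
  proof (intro subsetI CollectI conjI IntI)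
    fix g assume g: "g \<in> Pi\<^sub>E ?B ?A"
    show "g \<in> ?B \<rightarrow>\<^sub>E UNIV" using g by (auto simp: PiE_def)
    show "\<omega> \<bullet> hyperplane_chart \<omega> ?t g = ?t" by (rule inner_hyperplane_chart[OF \<omega>])
    have "hyperplane_chart \<omega> ?t g - x = (\<Sum>b\<in>?B. (g b - f b) *\<^sub>R b)"
      by (subst f) (simp add: hyperplane_chart_def sum_subtractf scaleR_diff_left)
    also have "norm \<dots> \<le> (\<Sum>b\<in>?B. r)"
    proof (rule sum_norm_le)
      fix b assume b: "b \<in> ?B"
      have "norm b = 1" using orthonormal_direction_basis[of \<omega>] b by (auto simp: orthonormal_basis_of_def)
      then show "norm ((g b - f b) *\<^sub>R b) \<le> r" using PiE_mem[OF g b] by (simp add: abs_le_iff)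
    qed
    also have "\<dots> < e" using e by (simp add: r_def field_simps)
    finally show "hyperplane_chart \<omega> ?t g \<in> D"
      using e(2) by (auto simp: dist_norm norm_minus_commute)
  qed
  have "0 < (\<Prod>b\<in>?B. ennreal (2 * r))" using r by (simp add: ennreal_power)
  also have "\<dots> = emeasure (\<Pi>\<^sub>M b\<in>?B. (lborel :: real measure)) (Pi\<^sub>E ?B ?A)"
    using r by (subst emeasure_hyperplane_box) auto
  also have "\<dots> \<le> emeasure (hyperplane_measure \<omega> ?t) (D \<inter> {x. \<omega> \<bullet> x = ?t})"
  proof -
    have "{g \<in> ?B \<rightarrow>\<^sub>E UNIV. hyperplane_chart \<omega> ?t g \<in> D \<inter> {x. \<omega> \<bullet> x = ?t}}
        \<in> sets (\<Pi>\<^sub>M b\<in>?B. (lborel :: real measure))"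
      using measurable_sets[OF measurable_hyperplane_chart section_in_borel[OF D(1)], of \<omega> ?t \<omega> ?t]
      by (auto simp: space_PiM vimage_def Int_def conj_commute cong: conj_cong)
    then show ?thesis
      unfolding emeasure_hyperplane_measure[OF section_in_borel[OF D(1)]] using sub by (intro emeasure_mono)
  qed
  finally have pos: "0 < emeasure (hyperplane_measure \<omega> ?t) (D \<inter> {x. \<omega> \<bullet> x = ?t})" .
  \<comment> \<open>Finiteness must be checked too, because \<open>measure\<close> assigns 0 to sets
    of infinite measure.\<close>
  obtain d where d: "\<And>y. y \<in> D \<Longrightarrow> norm y \<le> d" using D(2) by (auto simp: bounded_iff)
  have "norm (y - z) \<le> 2 * \<bar>d\<bar>" if "y \<in> D" "z \<in> D" for y z
    using d[OF that(1)] d[OF that(2)] norm_triangle_ineq4[of y z] by linarith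
  then have "emeasure (hyperplane_measure \<omega> ?t) (D \<inter> {x. \<omega> \<bullet> x = ?t}) < top"
    using emeasure_section_le[OF \<omega> D(1), of "2 * \<bar>d\<bar>" ?t] by (auto intro: le_less_trans ennreal_less_top)
  then show ?thesis using pos by (simp add: section_volume_def measure_def enn2real_positive_iff)
qed

text \<open>
  The two charts use the same basis, since \<^const>\<open>direction_basis\<close> depends only on the hyperplane
  orthogonal to \<open>\<omega>\<close>.
\<close>

lemma section_volume_minus:
  "section_volume D (- \<omega>) t = section_volume D \<omega> (- t)"
proof -
  have "direction_basis (- \<omega>) = direction_basis \<omega>" by (simp add: direction_basis_def)
  moreover have "{x. (- \<omega>) \<bullet> x = t} = {x. \<omega> \<bullet> x = - t}" by auto
  ultimately show ?thesis by (simp add: section_volume_def hyperplane_measure_def)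
qed

text \<open>For a good step \<epsilon>, the section at depth \<epsilon>^2 has diameter
  O(\<epsilon>), hence volume O(\<epsilon>^(2*m)), which is the m-th power of the depth up to a
  constant. Evenness of \<open>DIM('a) - 1\<close> makes this exponent an integer.\<close>

lemma frequently_section_volume_le:
  fixes D :: "'a::euclidean_space set"
  assumes D: "open D" "connected D" "D \<noteq> {}" "bounded D" and \<omega>: "norm \<omega> = 1"
    and quad: "frequently_quadratic_at (support_function D) \<omega>" and m: "DIM('a) - 1 = 2 * m"
  obtains K where "\<And>\<delta>. 0 < \<delta> \<Longrightarrow> \<exists>t. t \<noteq> support_function D \<omega> \<and> \<bar>t - support_function D \<omega>\<bar> < \<delta> \<and>
      D \<inter> {x. \<omega> \<bullet> x = t} \<noteq> {} \<and> section_volume D \<omega> t \<le> K * \<bar>t - support_function D \<omega>\<bar> ^ m"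
proof -
  let ?h = "support_function D \<omega>"
  obtain C where C: "\<And>\<delta>. 0 < \<delta> \<Longrightarrow> \<exists>\<epsilon>. 0 < \<epsilon> \<and> \<epsilon> < \<delta> \<and>
        (\<Sum>b\<in>Basis. second_difference (support_function D) (\<epsilon> *\<^sub>R b) \<omega>) < C * \<epsilon>\<^sup>2"
    using quad by (auto simp: frequently_quadratic_at_def)
  \<comment> \<open>The diameter constant of \<open>cap_diameter_le\<close>, with the absolute value
    of C to make it nonnegative.\<close>
  define A where "A = real DIM('a) * (\<bar>C\<bar> + 2)"
  obtain x where x: "x \<in> D" using D(3) by auto
  have xh: "\<omega> \<bullet> x < ?h"
  proof -
    obtain e where e: "e > 0" "cball x e \<subseteq> D" using D(1) x by (meson open_contains_cball)
    then have "x + e *\<^sub>R \<omega> \<in> D" using \<omega> by (auto simp: dist_norm)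
    then have "\<omega> \<bullet> (x + e *\<^sub>R \<omega>) \<le> ?h" by (rule inner_le_support_function[OF D(4,3)])
    then show ?thesis using e \<omega> by (simp add: inner_add_right norm_eq_1)
  qed
  have "\<exists>t. t \<noteq> ?h \<and> \<bar>t - ?h\<bar> < \<delta> \<and> D \<inter> {x. \<omega> \<bullet> x = t} \<noteq> {} \<and>
      section_volume D \<omega> t \<le> (2 * A) ^ (2 * m) * \<bar>t - ?h\<bar> ^ m" if \<delta>: "0 < \<delta>" for \<delta>
  proof -
    \<comment> \<open>The bound 1 gives \<epsilon>^2 < \<epsilon>. The other two then place t within
      \<delta> of the supporting value and above \<open>\<omega> \<bullet> x\<close>.\<close>
    obtain \<epsilon> where \<epsilon>: "0 < \<epsilon>" "\<epsilon> < min 1 (min \<delta> (?h - \<omega> \<bullet> x))"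
      and lt: "(\<Sum>b\<in>Basis. second_difference (support_function D) (\<epsilon> *\<^sub>R b) \<omega>) < C * \<epsilon>\<^sup>2"
      using C[of "min 1 (min \<delta> (?h - \<omega> \<bullet> x))"] \<delta> xh by auto
    have \<epsilon>2: "0 < \<epsilon>\<^sup>2" "\<epsilon>\<^sup>2 < \<epsilon>" using \<epsilon> by (auto simp: power2_eq_square)
    define t where "t = ?h - \<epsilon>\<^sup>2"
    obtain y where "y \<in> D" "t < \<omega> \<bullet> y"
      using less_support_function_iff[OF D(4,3), of t \<omega>] \<epsilon>2 by (auto simp: t_def)
    moreover have "\<omega> \<bullet> x < t" using \<epsilon> \<epsilon>2 by (simp add: t_def)
    \<comment> \<open>D has points on both sides of the hyperplane at t, so connectedness makes it
      meet D, where the volume equals the polynomial.\<close>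
    ultimately obtain w where "w \<in> D" "\<omega> \<bullet> w = t"
      using connected_ivt_hyperplane[OF D(2) x, of y \<omega> t] by auto
    then have meets: "D \<inter> {x. \<omega> \<bullet> x = t} \<noteq> {}" by blast
    have "section_volume D \<omega> t \<le> (2 * (A * \<epsilon>)) ^ (DIM('a) - 1)"
    proof (rule section_volume_le[OF \<omega> D(1)])
      show "0 \<le> A * \<epsilon>" using \<epsilon> by (simp add: A_def)
      have "C * \<epsilon>\<^sup>2 \<le> \<bar>C\<bar> * \<epsilon>\<^sup>2" by (intro mult_right_mono) auto
      with lt have "(\<Sum>b\<in>Basis. second_difference (support_function D) (\<epsilon> *\<^sub>R b) \<omega>) \<le> \<bar>C\<bar> * \<epsilon>\<^sup>2"
        by linarith
      then show "norm (y - z) \<le> A * \<epsilon>" if "y \<in> D" "z \<in> D" "\<omega> \<bullet> y = t" "\<omega> \<bullet> z = t" for y z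
        unfolding A_def using that \<epsilon> by (intro cap_diameter_le[OF D(4,3), where x = \<omega>]) (auto simp: t_def)
    qed
    also have "\<dots> = (2 * A) ^ (2 * m) * (\<epsilon>\<^sup>2) ^ m"
      unfolding m by (simp add: power_mult_distrib power_mult[symmetric] mult.assoc[symmetric])
    finally show ?thesis using meets \<epsilon> \<epsilon>2 by (intro exI[of _ t]) (auto simp: t_def)
  qed
  then show ?thesis using that by blast
qed

subsection \<open>The degree of the section polynomial\<close>

text \<open>Divide out the full power of the root: the cofactor q is nonzero at c. If the order were
  below m, q would be O(|t - c|) at points t arbitrarily close to c, contradicting
  continuity.\<close>

lemma order_ge_if_frequently_small:
  fixes p :: "real poly"
  assumes small: "\<And>\<delta>. 0 < \<delta> \<Longrightarrow> \<exists>t. t \<noteq> c \<and> \<bar>t - c\<bar> < \<delta> \<and> \<bar>poly p t\<bar> \<le> K * \<bar>t - c\<bar> ^ m"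
    and "p \<noteq> 0"
  shows "m \<le> order c p"
proof (rule ccontr)
  assume "\<not> ?thesis"
  then obtain k where k: "m = Suc (order c p) + k" using less_iff_Suc_add by (auto simp: not_le)
  obtain q where q: "p = [:-c, 1:] ^ order c p * q" "\<not> [:-c, 1:] dvd q"
    using order_decomp[OF \<open>p \<noteq> 0\<close>] by blast
  have qc: "poly q c \<noteq> 0" using q(2) by (simp add: poly_eq_0_iff_dvd)
  have "isCont (poly q) c" by simp
  then obtain \<delta> where \<delta>: "\<delta> > 0" "\<And>t. \<bar>t - c\<bar> < \<delta> \<Longrightarrow> \<bar>poly q t - poly q c\<bar> < \<bar>poly q c\<bar> / 2"
    using qc unfolding continuous_at_eps_delta dist_real_def
    by (metis half_gt_zero zero_less_abs_iff)
  \<comment> \<open>The three bounds serve \<open>s ^ k \<le> 1\<close>, the continuity estimate for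
    q, and \<open>(\<bar>K\<bar> + 1) * s < \<bar>poly q c\<bar> / 2\<close>. Adding 1 to the
    absolute value of K avoids division by zero.\<close>
  define \<eta> where "\<eta> = min 1 (min \<delta> (\<bar>poly q c\<bar> / (2 * (\<bar>K\<bar> + 1))))"
  have "\<eta> > 0" using \<delta> qc by (simp add: \<eta>_def)
  then obtain t where t: "t \<noteq> c" "\<bar>t - c\<bar> < \<eta>" and le: "\<bar>poly p t\<bar> \<le> K * \<bar>t - c\<bar> ^ m"
    using small by blast
  define s where "s = \<bar>t - c\<bar>"
  have s: "0 < s" "s < 1" "s < \<delta>" "s < \<bar>poly q c\<bar> / (2 * (\<bar>K\<bar> + 1))"
    using t by (auto simp: s_def \<eta>_def)
  have "s ^ order c p * \<bar>poly q t\<bar> = \<bar>poly p t\<bar>"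
    by (subst (2) q(1)) (simp add: abs_mult power_abs s_def)
  also have "\<dots> \<le> \<bar>K\<bar> * s ^ m"
    using le s(1) by (smt (verit) mult_right_mono s_def zero_le_power)
  also have "\<dots> = s ^ order c p * (\<bar>K\<bar> * s * s ^ k)" by (simp add: k power_add)
  also have "\<dots> \<le> s ^ order c p * (\<bar>K\<bar> * s * 1)"
    using s by (intro mult_left_mono power_le_one) auto
  finally have "\<bar>poly q t\<bar> \<le> \<bar>K\<bar> * s" using s(1) by simp
  also have "\<dots> \<le> (\<bar>K\<bar> + 1) * s" using s by simp
  also have "\<dots> < \<bar>poly q c\<bar> / 2" using s(4) by (simp add: field_simps)
  finally have "\<bar>poly q t\<bar> < \<bar>poly q c\<bar> / 2" .
  moreover have "\<bar>poly q t - poly q c\<bar> < \<bar>poly q c\<bar> / 2" using \<delta>(2) s(3) by (simp add: s_def)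
  ultimately show False by linarith
qed

text \<open>The two supporting values are distinct roots of p when m > 0, each of order at least m,
  so together they account for 2 * m in the degree.\<close>

lemma degree_ge_if_section_volume_eq_poly:
  fixes D :: "'a::euclidean_space set"
  assumes D: "open D" "connected D" "D \<noteq> {}" "bounded D" and \<omega>: "norm \<omega> = 1"
    and quad: "frequently_quadratic_at (support_function D) \<omega>"
      "frequently_quadratic_at (support_function D) (- \<omega>)"
    and m: "DIM('a) - 1 = 2 * m"
    and p: "\<And>t. D \<inter> {x. \<omega> \<bullet> x = t} \<noteq> {} \<Longrightarrow> section_volume D \<omega> t = poly p t"
  shows "2 * m \<le> degree p"
proof -
  \<comment> \<open>These are the supremum and the infimum of \<open>\<omega> \<bullet> y\<close>
    over D.\<close>
  let ?a = "support_function D \<omega>" and ?b = "- support_function D (- \<omega>)"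
  obtain x where x: "x \<in> D" using D(3) by auto
  have pos: "0 < poly p (\<omega> \<bullet> x)" if "x \<in> D" for x
  proof -
    have "D \<inter> {y. \<omega> \<bullet> y = \<omega> \<bullet> x} \<noteq> {}" using that by blast
    then show ?thesis using section_volume_pos[OF \<omega> D(1,4) that] p by simp
  qed
  then have "p \<noteq> 0" using x by fastforce
  have abs_p: "\<bar>poly p t\<bar> = section_volume D \<omega> t" if "D \<inter> {x. \<omega> \<bullet> x = t} \<noteq> {}" for t
    using p[OF that] pos that by force
  obtain K where K: "\<And>\<delta>. 0 < \<delta> \<Longrightarrow> \<exists>t. t \<noteq> ?a \<and> \<bar>t - ?a\<bar> < \<delta> \<and>
      D \<inter> {x. \<omega> \<bullet> x = t} \<noteq> {} \<and> section_volume D \<omega> t \<le> K * \<bar>t - ?a\<bar> ^ m"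
    using frequently_section_volume_le[OF D \<omega> quad(1) m] by blast
  have a: "m \<le> order ?a p"
    by (rule order_ge_if_frequently_small[OF _ \<open>p \<noteq> 0\<close>, where K = K]) (use K abs_p in metis)
  obtain K' where K': "\<And>\<delta>. 0 < \<delta> \<Longrightarrow> \<exists>t. t \<noteq> - ?b \<and> \<bar>t - - ?b\<bar> < \<delta> \<and>
      D \<inter> {x. - \<omega> \<bullet> x = t} \<noteq> {} \<and> section_volume D (- \<omega>) t \<le> K' * \<bar>t - - ?b\<bar> ^ m"
    using frequently_section_volume_le[OF D _ quad(2) m] \<omega> by auto
  have b: "m \<le> order ?b p"
  proof (rule order_ge_if_frequently_small[OF _ \<open>p \<noteq> 0\<close>, where K = K'])
    fix \<delta> :: real assume "0 < \<delta>"
    then obtain t where t: "t \<noteq> - ?b" "\<bar>t - - ?b\<bar> < \<delta>" "D \<inter> {x. - \<omega> \<bullet> x = t} \<noteq> {}"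
        "section_volume D (- \<omega>) t \<le> K' * \<bar>t - - ?b\<bar> ^ m"
      using K' by blast
    \<comment> \<open>Level t in direction -\<omega> is level -t in direction \<omega>, which
      carries the upper-end estimate over to the lower end.\<close>
    have "\<bar>- t - ?b\<bar> = \<bar>t - - ?b\<bar>" by linarith
    moreover have "{x. - \<omega> \<bullet> x = t} = {x. \<omega> \<bullet> x = - t}" by auto
    ultimately show "\<exists>t. t \<noteq> ?b \<and> \<bar>t - ?b\<bar> < \<delta> \<and> \<bar>poly p t\<bar> \<le> K' * \<bar>t - ?b\<bar> ^ m"
      using t abs_p[of "- t"] by (intro exI[of _ "- t"]) (auto simp: section_volume_minus)
  qed
  show ?thesis
  proof (cases "m = 0")
    case False
    \<comment> \<open>Equal ends would squeeze the open set D into a single hyperplane.\<close>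
    have "?a \<noteq> ?b"
    proof
      assume eq: "?a = ?b"
      have "\<omega> \<bullet> y = ?a" if "y \<in> D" for y
        using inner_le_support_function[OF D(4,3) that, of \<omega>]
          inner_le_support_function[OF D(4,3) that, of "- \<omega>"] eq by simp
      then have "{t. D \<inter> {x. \<omega> \<bullet> x = t} \<noteq> {}} \<subseteq> {?a}" by auto
      moreover have "\<omega> \<noteq> 0" using \<omega> by auto
      ultimately show False
        using infinite_hyperplanes_meeting_open[OF D(1,3)] by (meson finite.simps finite_subset)
    qed
    then have "m + m \<le> (\<Sum>x\<in>{?a, ?b}. order x p)" using a b by simp
    \<comment> \<open>Positive order is what makes both ends roots, hence the case split on
      m.\<close>
    also have "\<dots> \<le> (\<Sum>x | poly p x = 0. order x p)"
      using a b False \<open>p \<noteq> 0\<close>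
      by (intro sum_mono2 poly_roots_finite) (auto simp: order_root)
    also have "\<dots> \<le> degree p" by (rule sum_order_le_degree[OF \<open>p \<noteq> 0\<close>])
    finally show ?thesis by simp
  qed simp
qed

section \<open>From individual directions to almost all directions\<close>

lemma AE_surface_measure_support_function:
  fixes D :: "'a::euclidean_space set"
  assumes D: "D \<noteq> {}" "bounded D"
  shows "AE \<omega> in surface_measure. frequently_quadratic_at (support_function D) \<omega> \<and>
    frequently_quadratic_at (support_function D) (- \<omega>)"
proof -
  let ?h = "support_function D"
  obtain L where L: "\<And>x y. \<bar>?h x - ?h y\<bar> \<le> L * norm (x - y)"
    using support_function_lipschitz[OF D(2,1)] by blast
  note sd = second_difference_support_function_nonneg[OF D(2,1)]
  note hom = support_function_scale[OF D(2,1)]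
  have sd_minus: "second_difference (\<lambda>x. ?h (- x)) v x = second_difference ?h v (- x)" for v x
    by (simp add: second_difference_def)
  have "AE \<omega> in surface_measure. frequently_quadratic_at ?h \<omega>"
    by (rule AE_surface_measure_frequently_quadratic[OF L sd hom])
  \<comment> \<open>The reflected function satisfies the same hypotheses, so the opposite directions
    are treated without proving that the surface measure is invariant under reflection.\<close>
  moreover have "AE \<omega> in surface_measure. frequently_quadratic_at (\<lambda>x. ?h (- x)) \<omega>"
  proof (rule AE_surface_measure_frequently_quadratic)
    show "\<bar>?h (- x) - ?h (- y)\<bar> \<le> L * norm (x - y)" for x y
      using L[of "- x" "- y"] by (simp add: norm_minus_commute)
    show "?h (- (r *\<^sub>R x)) = r * ?h (- x)" if "0 < r" for r x
      using hom[OF that, of "- x"] by simp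
  qed (use sd in \<open>simp add: sd_minus\<close>)
  ultimately show ?thesis
    by eventually_elim (simp add: frequently_quadratic_at_def sd_minus)
qed

text \<open>For fixed \<omega> the coefficients assemble into one polynomial, and uniqueness
  identifies it with \<open>section_polynomial\<close>. Its degree can be below N when the leading
  coefficient vanishes at \<omega>.\<close>

lemma section_polynomial_of_degree:
  assumes "polynomially_integrable_of_degree N D" "open D" "D \<noteq> {}" "norm \<omega> = 1"
  shows "degree (section_polynomial D \<omega>) \<le> N"
    and "D \<inter> {x. \<omega> \<bullet> x = t} \<noteq> {} \<Longrightarrow> section_volume D \<omega> t = poly (section_polynomial D \<omega>) t"
proof -
  obtain a where a: "\<And>t. D \<inter> {x. \<omega> \<bullet> x = t} \<noteq> {} \<Longrightarrow> section_volume D \<omega> t = (\<Sum>j\<le>N. a j * t ^ j)"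
    using assms(1,4) unfolding polynomially_integrable_of_degree_def by force
  define p where "p = (\<Sum>j\<le>N. monom (a j) j)"
  have p: "section_volume D \<omega> t = poly p t" if "D \<inter> {x. \<omega> \<bullet> x = t} \<noteq> {}" for t
    using a[OF that] by (simp add: p_def poly_sum poly_monom)
  have "\<omega> \<noteq> 0" using assms(4) by auto
  then have eq: "section_polynomial D \<omega> = p"
    using assms(2,3) p by (intro section_polynomial_eqI)
  show "degree (section_polynomial D \<omega>) \<le> N"
    unfolding eq p_def by (intro degree_sum_le) (auto intro: order_trans[OF degree_monom_le])
  show "section_volume D \<omega> t = poly (section_polynomial D \<omega>) t" if "D \<inter> {x. \<omega> \<bullet> x = t} \<noteq> {}"
    using p[OF that] by (simp add: eq)
qed

lemma AE_degree_section_polynomial_ge: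
  fixes D :: "'a::euclidean_space set"
  assumes D: "open D" "connected D" "D \<noteq> {}" "bounded D"
    and poly: "polynomially_integrable_of_degree N D" and odd: "odd DIM('a)"
  shows "AE \<omega> in surface_measure. DIM('a) - 1 \<le> degree (section_polynomial D \<omega>)"
proof -
  obtain m where "DIM('a) = 2 * m + 1" using odd by (rule oddE)
  then have m: "DIM('a) - 1 = 2 * m" by simp
  show ?thesis
    using AE_surface_measure_support_function[OF D(3,4)]
  proof (rule AE_mp, intro AE_I2 impI)
    fix \<omega> :: 'a assume "\<omega> \<in> space surface_measure"
      and quad: "frequently_quadratic_at (support_function D) \<omega> \<and>
        frequently_quadratic_at (support_function D) (- \<omega>)"
    then have \<omega>: "norm \<omega> = 1" by (simp add: space_surface_measure)
    show "DIM('a) - 1 \<le> degree (section_polynomial D \<omega>)"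
      unfolding m using quad section_polynomial_of_degree(2)[OF poly D(1,3) \<omega>]
      by (intro degree_ge_if_section_volume_eq_poly[OF D \<omega> _ _ m]) auto
  qed
qed

text \<open>Ensures that a property holding almost everywhere on the sphere holds somewhere. The
  cone over the whole sphere is the punctured unit ball.\<close>

lemma emeasure_surface_measure_sphere_neq_0:
  "emeasure surface_measure (sphere (0::'a::euclidean_space) 1) \<noteq> 0"
proof -
  have "{x \<in> ball (0::'a) 1 - {0}. sgn x \<in> sphere 0 1} = ball 0 1 - {0}"
    by (auto simp: norm_sgn)
  moreover have "emeasure lborel (ball (0::'a) 1 - {0}) = emeasure lborel (ball (0::'a) 1)"
    by (rule emeasure_Diff_null_set) auto
  moreover have "emeasure lborel (ball (0::'a) 1) > 0"
    by (simp add: emeasure_ball unit_ball_vol_pos)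
  ultimately show ?thesis by (simp add: emeasure_surface_measure)
qed

text \<open>N bounds the degree in every direction, so a smaller N would contradict the
  almost-everywhere bound on a sphere of nonzero measure.\<close>

lemma polynomially_integrable_of_degree_ge:
  fixes D :: "'a::euclidean_space set"
  assumes D: "open D" "connected D" "D \<noteq> {}" "bounded D"
    and poly: "polynomially_integrable_of_degree N D" and odd: "odd DIM('a)"
  shows "DIM('a) - 1 \<le> N"
proof (rule ccontr)
  assume "\<not> ?thesis"
  then have less: "\<not> DIM('a) - 1 \<le> degree (section_polynomial D \<omega>)" if "\<omega> \<in> space surface_measure" for \<omega>
    using section_polynomial_of_degree(1)[OF poly D(1,3), of \<omega>] that by (simp add: space_surface_measure)
  have "AE \<omega>::'a in surface_measure. False"
    using AE_degree_section_polynomial_ge[OF assms]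
    by (rule AE_mp) (use less in \<open>intro AE_I2 impI, blast\<close>)
  then have "emeasure surface_measure (space (surface_measure :: 'a measure)) = 0"
    by (subst (asm) AE_iff_measurable[OF sets.top]) auto
  then show False using emeasure_surface_measure_sphere_neq_0[where 'a = 'a]
    by (simp add: space_surface_measure)
qed

theorem theorem7:
  assumes "odd CARD('n::finite)"
  shows
    "(\<forall>D :: (real ^ 'n) set.
        open D \<and> connected D \<and> D \<noteq> {} \<and> bounded D \<and> smooth_boundary D \<and>
        polynomially_integrable D \<longrightarrow>
        (AE \<omega> in surface_measure. CARD('n) - 1 \<le> degree (section_polynomial D \<omega>))) \<and>
     \<not> (\<exists>(D :: (real ^ 'n) set) N.
        open D \<and> connected D \<and> D \<noteq> {} \<and> bounded D \<and> smooth_boundary D \<and>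
        polynomially_integrable_of_degree N D \<and> N < CARD('n) - 1)"
proof -
  have dim: "DIM(real ^ 'n) = CARD('n)" by simp
  then have odd: "odd DIM(real ^ 'n)" using assms by simp
  show ?thesis
    unfolding polynomially_integrable_def
    using AE_degree_section_polynomial_ge[OF _ _ _ _ _ odd]
      polynomially_integrable_of_degree_ge[OF _ _ _ _ _ odd]
    unfolding dim by (meson not_less)
qed

end
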